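(* Let $\mathfrak g$ and $\mathfrak h$ be Leibniz algebras, and let $\mathfrak g\oplus\mathfrak h$ be their direct sum Leibniz algebra. Then $\partial(C^k_>(\mathfrak g\oplus\mathfrak h,\mathfrak h))\subset C^{k+1}_>(\mathfrak g\oplus\mathfrak h,\mathfrak h)$ for all $k\ge0$, and $(C_>(\mathfrak g\oplus\mathfrak h,\mathfrak h),[\cdot,\cdot]_C,\overline\partial)$ is a sub-DGLA of $(C(\mathfrak g\oplus\mathfrak h,\mathfrak g\oplus\mathfrak h),[\cdot,\cdot]_C,\overline\partial)$. Furthermore, its degree $0$ part $C^0_>(\mathfrak g\oplus\mathfrak h,\mathfrak h)=\mathrm{Hom}(\mathfrak g,\mathfrak h)$ is abelian.
   Context: All vector spaces are over a fixed ground field. A (left) Leibniz algebra is a vector space with a bilinear bracket satisfying $[x,[y,z]]=[[x,y],z]+[y,[x,z]]$. The direct sum $\mathfrak g\oplus\mathfrak h$ has bracket $[x+\alpha,y+\beta]=[x,y]_{\mathfrak g}+[\alpha,\beta]_{\mathfrak h}$. For a Leibniz algebra $E$ put $C^k(E,E)=\mathrm{Hom}(\otimes^{k+1}E,E)$, $k\ge0$, and $C(E,E)=\oplus_kC^k(E,E)$. For $P\in C^p(E,E)$, $Q\in C^q(E,E)$, $P\circ Q\in C^{p+q}(E,E)$ is $$P\circ Q(x_1,\dots,x_{p+q+1})=\sum_{k=0}^p(-1)^{kq}\sum_{\sigma\in sh(k,q)}\mathrm{sgn}(\sigma)P(x_{\sigma(1)},\dots,x_{\sigma(k)},Q(x_{\sigma(k+1)},\dots,x_{\sigma(k+q)},x_{k+q+1}),x_{k+q+2},\dots,x_{p+q+1}),$$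 where $sh(k,q)$ is the set of $(k,q)$-shuffles, and $[P,Q]_C=P\circ Q+(-1)^{pq+1}Q\circ P$. The coboundary operator $\partial:C^{k-1}(E,E)\to C^k(E,E)$ (adjoint representation) is $$\partial c(x_1,\dots,x_{k+1})=\sum_{i=1}^k(-1)^{i+1}[x_i,c(x_1,\dots,\widehat{x_i},\dots,x_{k+1})]+(-1)^{k+1}[c(x_1,\dots,x_k),x_{k+1}]+\sum_{1\le i<j\le k+1}(-1)^ic(x_1,\dots,\widehat{x_i},\dots,x_{j-1},[x_i,x_j],x_{j+1},\dots,x_{k+1}),$$ and $\overline\partial P=(-1)^p\partial P$ for $P\in C^p(E,E)$; equivalently $\overline\partial P=[\mu,P]_C$ with $\mu(x,y)=[x,y]$ the bracket of $E$. It is known that $(C(E,E),[\cdot,\cdot]_C,\overline\partial)$ is a differential graded Lie algebra (DGLA). Take $E=\mathfrak g\oplus\mathfrak h$ and $C^k(\mathfrak g\oplus\mathfrak h,\mathfrak h)=\mathrm{Hom}(\otimes^{k+1}(\mathfrak g\oplus\mathfrak h),\mathfrak h)\subset C^k(E,E)$. $C^k_>(\mathfrak g\oplus\mathfrak h,\mathfrak h)$ denotes the subspace of those maps that vanish on $\otimes^{k+1}\mathfrak h$, i.e. the natural complement in $C^k(\mathfrak g\oplus\mathfrak h,\mathfrak h)=C^k_>(\mathfrak g\oplus\mathfrak h,\mathfrak h)\oplus C^k(\mathfrak h,\mathfrak h)$ with $C^k(\mathfrak h,\mathfrak h)=\mathrm{Hom}(\otimes^{k+1}\mathfrak h,\mathfrak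 h)$. $C_>(\mathfrak g\oplus\mathfrak h,\mathfrak h)=\oplus_kC^k_>(\mathfrak g\oplus\mathfrak h,\mathfrak h)$. *)

theory Defs
  imports
    "HOL-Analysis.Product_Vector"
    "HOL-Library.Function_Algebras"
    "HOL-Combinatorics.Permutations"
begin

section \<open>Leibniz algebras\<close>

locale leibniz_algebra = vector_space s
  for s :: "'k::field \<Rightarrow> 'a::ab_group_add \<Rightarrow> 'a" +
  fixes br :: "'a \<Rightarrow> 'a \<Rightarrow> 'a"
  assumes linear_left: "Vector_Spaces.linear s s (\<lambda>x. br x y)"
    and linear_right: "Vector_Spaces.linear s s (\<lambda>y. br x y)"
    and leibniz: "br x (br y z) = br (br x y) z + br y (br x z)"

abbreviation dsum_scale ::
    "('k::field \<Rightarrow> 'g::ab_group_add \<Rightarrow> 'g) \<Rightarrow> ('k \<Rightarrow> 'h::ab_group_add \<Rightarrow> 'h) \<Rightarrow>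
      'k \<Rightarrow> 'g \<times> 'h \<Rightarrow> 'g \<times> 'h"
  where "dsum_scale \<equiv> module_prod.scale"

definition dsum_br ::
    "('g \<Rightarrow> 'g \<Rightarrow> 'g) \<Rightarrow> ('h \<Rightarrow> 'h \<Rightarrow> 'h) \<Rightarrow> 'g \<times> 'h \<Rightarrow> 'g \<times> 'h \<Rightarrow> 'g \<times> 'h"
  where "dsum_br brg brh u v = (brg (fst u) (fst v), brh (snd u) (snd v))"

lemma leibniz_algebra_dsum:
  fixes sg :: "'k::field \<Rightarrow> 'g::ab_group_add \<Rightarrow> 'g" and sh :: "'k \<Rightarrow> 'h::ab_group_add \<Rightarrow> 'h"
  assumes "leibniz_algebra sg brg" and "leibniz_algebra sh brh"
  shows "leibniz_algebra (dsum_scale sg sh) (dsum_br brg brh)"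
proof -
  interpret g: leibniz_algebra sg brg by fact
  interpret h: leibniz_algebra sh brh by fact
  interpret p: vector_space_prod sg sh ..
  have g: "brg (x + y) z = brg x z + brg y z" "brg (sg c x) z = sg c (brg x z)"
    "brg z (x + y) = brg z x + brg z y" "brg z (sg c x) = sg c (brg z x)" for x y z c
    using g.linear_left[of z] g.linear_right[of z] by (simp_all add: Vector_Spaces.linear_iff)
  have h: "brh (x + y) z = brh x z + brh y z" "brh (sh c x) z = sh c (brh x z)"
    "brh z (x + y) = brh z x + brh z y" "brh z (sh c x) = sh c (brh z x)" for x y z c
    using h.linear_left[of z] h.linear_right[of z] by (simp_all add: Vector_Spaces.linear_iff)
  have vs: "vector_space (dsum_scale sg sh)" ..
  show ?thesis
  proof (rule leibniz_algebra.intro[OF vs], rule leibniz_algebra_axioms.intro)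
    fix x y z :: "'g \<times> 'h"
    show "Vector_Spaces.linear (dsum_scale sg sh) (dsum_scale sg sh) (\<lambda>x. dsum_br brg brh x z)"
      and "Vector_Spaces.linear (dsum_scale sg sh) (dsum_scale sg sh) (dsum_br brg brh z)"
      using vs by (simp_all add: Vector_Spaces.linear_iff dsum_br_def p.scale_def g h)
    show "dsum_br brg brh x (dsum_br brg brh y z) =
        dsum_br brg brh (dsum_br brg brh x y) z + dsum_br brg brh y (dsum_br brg brh x z)"
      unfolding dsum_br_def fst_conv snd_conv plus_prod_def
      by (intro arg_cong2[where f = Pair] g.leibniz h.leibniz)
  qed
qed

section \<open>Differential graded Lie algebras\<close>

text \<open>
  A graded space is given by the family \<open>L\<close> of its homogeneous components, all subspaces of one
  ambient space. The bracket and the differential carry the degrees of their arguments as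
  extra arguments: \<open>br p q\<close> maps \<open>L p \<times> L q\<close> to \<open>L (p + q)\<close>, and \<open>d p\<close> maps \<open>L p\<close> to
  \<open>L (Suc p)\<close>. Nothing is required of them outside these components.
\<close>

locale dgla = vector_space s
  for s :: "'k::field \<Rightarrow> 'v::ab_group_add \<Rightarrow> 'v" +
  fixes L :: "nat \<Rightarrow> 'v set"
    and br :: "nat \<Rightarrow> nat \<Rightarrow> 'v \<Rightarrow> 'v \<Rightarrow> 'v"
    and d :: "nat \<Rightarrow> 'v \<Rightarrow> 'v"
  assumes subspace_component: "subspace (L p)"
    and br_closed: "\<lbrakk>x \<in> L p; y \<in> L q\<rbrakk> \<Longrightarrow> br p q x y \<in> L (p + q)"
    and br_add_left: "\<lbrakk>x \<in> L p; x' \<in> L p; y \<in> L q\<rbrakk> \<Longrightarrow> br p q (x + x') y = br p q x y + br p q x' y"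
    and br_scale_left: "\<lbrakk>x \<in> L p; y \<in> L q\<rbrakk> \<Longrightarrow> br p q (s c x) y = s c (br p q x y)"
    and br_skew: "\<lbrakk>x \<in> L p; y \<in> L q\<rbrakk> \<Longrightarrow> br p q x y = s ((-1) ^ (p * q + 1)) (br q p y x)"
    and jacobi: "\<lbrakk>x \<in> L p; y \<in> L q; z \<in> L r\<rbrakk> \<Longrightarrow>
      br p (q + r) x (br q r y z) =
        br (p + q) r (br p q x y) z + s ((-1) ^ (p * q)) (br q (p + r) y (br p r x z))"
    and d_closed: "x \<in> L p \<Longrightarrow> d p x \<in> L (Suc p)"
    and d_add: "\<lbrakk>x \<in> L p; x' \<in> L p\<rbrakk> \<Longrightarrow> d p (x + x') = d p x + d p x'"
    and d_scale: "x \<in> L p \<Longrightarrow> d p (s c x) = s c (d p x)"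
    and d_squared: "x \<in> L p \<Longrightarrow> d (Suc p) (d p x) = 0"
    and d_derivation: "\<lbrakk>x \<in> L p; y \<in> L q\<rbrakk> \<Longrightarrow>
      d (p + q) (br p q x y) = br (Suc p) q (d p x) y + s ((-1) ^ p) (br p (Suc q) x (d q y))"

text \<open>
  A sub-DGLA is a graded subspace closed under the bracket and the differential; the identities
  are inherited from the ambient DGLA.
\<close>

definition sub_dgla ::
    "('k::field \<Rightarrow> 'v::ab_group_add \<Rightarrow> 'v) \<Rightarrow> (nat \<Rightarrow> 'v set) \<Rightarrow>
      (nat \<Rightarrow> nat \<Rightarrow> 'v \<Rightarrow> 'v \<Rightarrow> 'v) \<Rightarrow> (nat \<Rightarrow> 'v \<Rightarrow> 'v) \<Rightarrow> (nat \<Rightarrow> 'v set) \<Rightarrow> bool"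
  where "sub_dgla s L br d S \<longleftrightarrow>
    (\<forall>p. S p \<subseteq> L p \<and> module.subspace s (S p)) \<and>
    (\<forall>p q. \<forall>x \<in> S p. \<forall>y \<in> S q. br p q x y \<in> S (p + q)) \<and>
    (\<forall>p. \<forall>x \<in> S p. d p x \<in> S (Suc p))"

lemma dgla_sub_dgla:
  assumes "dgla s L br d" and "sub_dgla s L br d S"
  shows "dgla s S br d"
proof -
  interpret dgla s L br d by fact
  have S: "x \<in> L p" if "x \<in> S p" for x p
    using that assms(2) by (auto simp: sub_dgla_def)
  show ?thesis
  proof unfold_locales
    show "subspace (S p)" for p
      using assms(2) by (simp add: sub_dgla_def)
    show "br p q x y \<in> S (p + q)" if "x \<in> S p" "y \<in> S q" for x y p q
      using that assms(2) by (simp add: sub_dgla_def)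
    show "d p x \<in> S (Suc p)" if "x \<in> S p" for x p
      using that assms(2) by (simp add: sub_dgla_def)
  qed (rule br_add_left br_scale_left br_skew jacobi d_add d_scale d_squared d_derivation;
      (rule S, assumption))+
qed

section \<open>Cochains\<close>

text \<open>
  An element of \<open>C\<^sup>k(E,E) = Hom(\<otimes>\<^sup>k\<^sup>+\<^sup>1 E, E)\<close> is a multilinear map of \<open>k + 1\<close> arguments,
  represented as a function on lists that is \<open>0\<close> on all lists of length different from \<open>k + 1\<close>.
\<close>

definition cochains :: "('k::field \<Rightarrow> 'e::ab_group_add \<Rightarrow> 'e) \<Rightarrow> nat \<Rightarrow> ('e list \<Rightarrow> 'e) set"
  where "cochains s k = {P.
    (\<forall>xs. length xs \<noteq> k + 1 \<longrightarrow> P xs = 0) \<and>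
    (\<forall>xs i. length xs = k + 1 \<and> i < k + 1 \<longrightarrow> Vector_Spaces.linear s s (\<lambda>v. P (xs[i := v])))}"

definition fun_scale :: "('k \<Rightarrow> 'b \<Rightarrow> 'b) \<Rightarrow> 'k \<Rightarrow> ('a \<Rightarrow> 'b) \<Rightarrow> 'a \<Rightarrow> 'b"
  where "fun_scale s c f = (\<lambda>x. s c (f x))"

lemma vector_space_fun_scale: "vector_space s \<Longrightarrow> vector_space (fun_scale s)"
  by (auto simp: vector_space_def fun_scale_def fun_eq_iff)

definition shuffles :: "nat \<Rightarrow> nat \<Rightarrow> (nat \<Rightarrow> nat) set"
  where "shuffles k q = {\<sigma>. \<sigma> permutes {1..k + q} \<and>
    strict_mono_on {1..k} \<sigma> \<and> strict_mono_on {k + 1..k + q} \<sigma>}"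

text \<open>In the following formulas arguments are numbered from 1, so \<open>x\<^sub>i\<close> is \<open>xs ! (i - 1)\<close>.\<close>

definition circ ::
    "('k::field \<Rightarrow> 'e::ab_group_add \<Rightarrow> 'e) \<Rightarrow> nat \<Rightarrow> nat \<Rightarrow>
      ('e list \<Rightarrow> 'e) \<Rightarrow> ('e list \<Rightarrow> 'e) \<Rightarrow> 'e list \<Rightarrow> 'e"
  where "circ s p q P Q xs =
    (if length xs = p + q + 1
     then \<Sum>k = 0..p. s ((-1) ^ (k * q)) (\<Sum>\<sigma> \<in> shuffles k q. s (of_int (sign \<sigma>))
       (P (map (\<lambda>i. xs ! (\<sigma> i - 1)) [1..<k + 1] @
           [Q (map (\<lambda>i. xs ! (\<sigma> i - 1)) [k + 1..<k + q + 1] @ [xs ! (k + q + 1 - 1)])] @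
           drop (k + q + 1) xs)))
     else 0)"

definition bracketC ::
    "('k::field \<Rightarrow> 'e::ab_group_add \<Rightarrow> 'e) \<Rightarrow> nat \<Rightarrow> nat \<Rightarrow>
      ('e list \<Rightarrow> 'e) \<Rightarrow> ('e list \<Rightarrow> 'e) \<Rightarrow> 'e list \<Rightarrow> 'e"
  where "bracketC s p q P Q = circ s p q P Q + fun_scale s ((-1) ^ (p * q + 1)) (circ s q p Q P)"

definition omit :: "nat \<Rightarrow> 'e list \<Rightarrow> 'e list"
  where "omit i xs = take (i - 1) xs @ drop i xs"

text \<open>\<open>coboundary s br p\<close> is \<open>\<partial>\<close> on \<open>C\<^sup>p(E,E)\<close>; in the usual formula for \<open>\<partial>\<close> on \<open>C\<^sup>k\<^sup>-\<^sup>1\<close>, \<open>k = p + 1\<close>.\<close>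

definition coboundary ::
    "('k::field \<Rightarrow> 'e::ab_group_add \<Rightarrow> 'e) \<Rightarrow> ('e \<Rightarrow> 'e \<Rightarrow> 'e) \<Rightarrow> nat \<Rightarrow>
      ('e list \<Rightarrow> 'e) \<Rightarrow> 'e list \<Rightarrow> 'e"
  where "coboundary s br p c xs = (let k = p + 1 in
    if length xs = k + 1
    then (\<Sum>i = 1..k. s ((-1) ^ (i + 1)) (br (xs ! (i - 1)) (c (omit i xs))))
      + s ((-1) ^ (k + 1)) (br (c (take k xs)) (xs ! k))
      + (\<Sum>(i, j) \<in> {(i, j). 1 \<le> i \<and> i < j \<and> j \<le> k + 1}.
          s ((-1) ^ i) (c (omit i (xs[j - 1 := br (xs ! (i - 1)) (xs ! (j - 1))]))))
    else 0)"

definition coboundary_bar ::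
    "('k::field \<Rightarrow> 'e::ab_group_add \<Rightarrow> 'e) \<Rightarrow> ('e \<Rightarrow> 'e \<Rightarrow> 'e) \<Rightarrow> nat \<Rightarrow>
      ('e list \<Rightarrow> 'e) \<Rightarrow> 'e list \<Rightarrow> 'e"
  where "coboundary_bar s br p P = fun_scale s ((-1) ^ p) (coboundary s br p P)"

section \<open>Cochains with values in the second summand\<close>

definition second_summand :: "('g::zero \<times> 'h) set"
  where "second_summand = {0} \<times> UNIV"

definition cochains_into_snd ::
    "('k::field \<Rightarrow> 'g::ab_group_add \<Rightarrow> 'g) \<Rightarrow> ('k \<Rightarrow> 'h::ab_group_add \<Rightarrow> 'h) \<Rightarrow> nat \<Rightarrow>
      (('g \<times> 'h) list \<Rightarrow> 'g \<times> 'h) set"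
  where "cochains_into_snd sg sh k =
    {P \<in> cochains (dsum_scale sg sh) k. \<forall>xs. P xs \<in> second_summand}"

definition cochains_gt ::
    "('k::field \<Rightarrow> 'g::ab_group_add \<Rightarrow> 'g) \<Rightarrow> ('k \<Rightarrow> 'h::ab_group_add \<Rightarrow> 'h) \<Rightarrow> nat \<Rightarrow>
      (('g \<times> 'h) list \<Rightarrow> 'g \<times> 'h) set"
  where "cochains_gt sg sh k =
    {P \<in> cochains_into_snd sg sh k.
      \<forall>xs. length xs = k + 1 \<and> set xs \<subseteq> second_summand \<longrightarrow> P xs = 0}"

text \<open>A map \<open>f : \<gg> \<rightarrow> \<hh>\<close>, viewed as the cochain \<open>x + \<alpha> \<mapsto> f(x)\<close> of degree \<open>0\<close>.\<close>

definition hom_cochain ::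
    "('g::ab_group_add \<Rightarrow> 'h::ab_group_add) \<Rightarrow> ('g \<times> 'h) list \<Rightarrow> 'g \<times> 'h"
  where "hom_cochain f xs = (if length xs = 1 then (0, f (fst (xs ! 0))) else 0)"

end

theory Submission
  imports Defs
begin

text \<open>
  Being a sub-DGLA is a matter of closure only, so two things have to be seen.

  First, the bracket and the coboundary of multilinear maps are multilinear. Every summand of
  \<open>P \<circ> Q\<close> arises by inserting \<open>Q\<close> into one slot of \<open>P\<close> and permuting the
  arguments (\<open>multilinear_insert\<close>, \<open>multilinear_permute\<close>), and every summand of
  \<open>\<partial>c\<close> uses each argument exactly once in a bilinear way
  (\<open>multilinear_pair_omit\<close>, \<open>multilinear_omit_contract\<close>).

  Second, \<open>\<hh>\<close> is an ideal of \<open>\<gg> \<oplus> \<hh>\<close>. So taking brackets with values in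
  \<open>\<hh>\<close> stays in \<open>\<hh>\<close>, and a cochain with values in \<open>\<hh>\<close>, once inserted
  into another one, keeps all arguments in \<open>\<hh>\<close> if they were there at the start. Therefore,
  on arguments from \<open>\<hh>\<close>, the outer map of every summand of \<open>P \<circ> Q\<close> is evaluated
  on \<open>\<hh>\<close> alone, where it vanishes, and every summand of \<open>\<partial>c\<close> contains a
  value of \<open>c\<close> on \<open>\<hh>\<close>. For the same reason \<open>P \<circ> Q = 0\<close> in degree
  \<open>0\<close>, whatever the arguments: there \<open>P \<circ> Q\<close> is the composite of two linear maps
  with image in \<open>\<hh>\<close> that vanish on \<open>\<hh>\<close>, which are exactly the linear maps
  \<open>\<gg> \<rightarrow> \<hh>\<close>.
\<close>

section \<open>Multilinear functions on lists\<close>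

definition multilinear ::
    "('k::field \<Rightarrow> 'e::ab_group_add \<Rightarrow> 'e) \<Rightarrow> nat \<Rightarrow> ('e list \<Rightarrow> 'e) \<Rightarrow> bool"
  where "multilinear s n P \<longleftrightarrow>
    (\<forall>xs i. length xs = n \<and> i < n \<longrightarrow> Vector_Spaces.linear s s (\<lambda>v. P (xs[i := v])))"

lemma multilinearI:
  "(\<And>xs i. length xs = n \<Longrightarrow> i < n \<Longrightarrow> Vector_Spaces.linear s s (\<lambda>v. P (xs[i := v]))) \<Longrightarrow>
    multilinear s n P"
  by (simp add: multilinear_def)

lemma multilinearD:
  "multilinear s n P \<Longrightarrow> length xs = n \<Longrightarrow> i < n \<Longrightarrow>
    Vector_Spaces.linear s s (\<lambda>v. P (xs[i := v]))"
  by (simp add: multilinear_def)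

lemma cochains_iff_multilinear:
  "P \<in> cochains s k \<longleftrightarrow> (\<forall>xs. length xs \<noteq> k + 1 \<longrightarrow> P xs = 0) \<and> multilinear s (k + 1) P"
  by (auto simp: cochains_def multilinear_def)

lemma multilinear_cong:
  assumes "\<And>xs. length xs = n \<Longrightarrow> P xs = Q xs"
  shows "multilinear s n P \<longleftrightarrow> multilinear s n Q"
  using assms by (simp add: multilinear_def)

lemma (in vector_space) multilinear_add:
  "multilinear scale n P \<Longrightarrow> multilinear scale n Q \<Longrightarrow> multilinear scale n (\<lambda>xs. P xs + Q xs)"
  by (simp add: multilinear_def Vector_Spaces.linear_iff scale_right_distrib)

lemma (in vector_space) multilinear_scale:
  "multilinear scale n P \<Longrightarrow> multilinear scale n (\<lambda>xs. scale a (P xs))"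
  by (simp add: multilinear_def Vector_Spaces.linear_iff scale_right_distrib mult.commute)

lemma (in vector_space) multilinear_sum:
  "(\<And>j. j \<in> A \<Longrightarrow> multilinear scale n (P j)) \<Longrightarrow> multilinear scale n (\<lambda>xs. \<Sum>j\<in>A. P j xs)"
  by (simp add: multilinear_def Vector_Spaces.linear_iff vector_space_axioms sum.distrib
      scale_sum_right)

text \<open>Every argument occurs exactly once after the permutation, namely in slot \<open>inv \<pi> i\<close>.\<close>

lemma multilinear_permute:
  assumes P: "multilinear s n P" and \<pi>: "\<pi> permutes {..<n}"
  shows "multilinear s n (\<lambda>xs. P (permute_list \<pi> xs))"
proof (rule multilinearI)
  fix xs :: "'b list" and i assume len: "length xs = n" and i: "i < n"
  have j: "inv \<pi> i < n"
    using permutes_in_image[OF permutes_inv[OF \<pi>], of i] i by simp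
  have "permute_list \<pi> (xs[i := v]) = (permute_list \<pi> xs)[inv \<pi> i := v]" for v
  proof (rule nth_equalityI)
    fix l assume "l < length (permute_list \<pi> (xs[i := v]))"
    then have l: "l < n" using len by simp
    have "\<pi> l < n" using permutes_in_image[OF \<pi>, of l] l by simp
    moreover have "\<pi> l = i \<longleftrightarrow> l = inv \<pi> i"
      using permutes_inv_eq[OF \<pi>] by metis
    ultimately show "permute_list \<pi> (xs[i := v]) ! l = (permute_list \<pi> xs)[inv \<pi> i := v] ! l"
      using l len \<pi> by (auto simp: permute_list_nth nth_list_update)
  qed (simp add: len)
  then show "Vector_Spaces.linear s s (\<lambda>v. P (permute_list \<pi> (xs[i := v])))"
    using multilinearD[OF P _ j] len by simp
qed

text \<open>
  An argument of the composite lies before, inside or behind the inserted block; correspondingly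
  it is an argument of \<open>P\<close>, of \<open>Q\<close>, or an argument of \<open>P\<close> shifted by \<open>q\<close> places.
\<close>

lemma multilinear_insert:
  assumes P: "multilinear s (p + 1) P" and Q: "multilinear s (q + 1) Q" and k: "k \<le> p"
  shows "multilinear s (p + q + 1)
    (\<lambda>xs. P (take k xs @ [Q (take (q + 1) (drop k xs))] @ drop (k + q + 1) xs))"
proof (rule multilinearI)
  fix xs :: "'b list" and i assume len: "length xs = p + q + 1" and i: "i < p + q + 1"
  let ?zs = "\<lambda>xs. take k xs @ [Q (take (q + 1) (drop k xs))] @ drop (k + q + 1) xs"
  have zs: "length (?zs xs) = p + 1" using len k by simp
  consider "i < k" | "k \<le> i" "i < k + q + 1" | "k + q + 1 \<le> i" by linarith
  then show "Vector_Spaces.linear s s (\<lambda>v. P (?zs (xs[i := v])))"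
  proof cases
    case 1
    then have "?zs (xs[i := v]) = (?zs xs)[i := v]" for v
      using len k by (simp add: take_update_swap drop_update_cancel list_update_append)
    then show ?thesis using multilinearD[OF P zs, of i] 1 k by simp
  next
    case 2
    let ?ws = "take (q + 1) (drop k xs)"
    have "?zs (xs[i := v]) = (?zs xs)[k := Q (?ws[i - k := v])]" for v
      using 2 len k
      by (simp add: take_update_swap drop_update_swap drop_update_cancel list_update_append
          list_update_beyond)
    moreover have "Vector_Spaces.linear s s (\<lambda>v. Q (?ws[i - k := v]))"
      using 2 len k by (intro multilinearD[OF Q]) auto
    moreover have "Vector_Spaces.linear s s (\<lambda>v. P ((?zs xs)[k := v]))"
      using k by (intro multilinearD[OF P zs]) simp
    ultimately show ?thesis
      using Vector_Spaces.linear_compose[of s s "\<lambda>v. Q (?ws[i - k := v])" s] by (simp add: o_def)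
  next
    case 3
    then obtain r where "i = k + q + 1 + r" using le_Suc_ex by blast
    then have "?zs (xs[i := v]) = (?zs xs)[i - q := v]" for v
      using len k
      by (simp add: take_update_swap drop_update_swap list_update_append list_update_beyond)
    then show ?thesis using multilinearD[OF P zs, of "i - q"] 3 i by simp
  qed
qed

lemma linear_imp_0:
  assumes "Vector_Spaces.linear s1 s2 f"
  shows "f 0 = 0"
proof -
  interpret Vector_Spaces.linear s1 s2 f by fact
  show ?thesis by (rule zero)
qed

section \<open>The composition product\<close>

text \<open>
  The permutation is \<open>\<sigma>\<close> itself, with positions counted from \<open>0\<close> and extended by the
  identity to all positions. It separates the shuffling of the arguments from the insertion.
\<close>

lemma shuffle_arguments_eq_permute_list:
  assumes \<sigma>: "\<sigma> permutes {1..m}" and m: "m < n"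
  defines "\<pi> \<equiv> \<lambda>i. \<sigma> (i + 1) - 1"
  shows "\<pi> permutes {..<n}"
    and "length xs = n \<Longrightarrow> k \<le> m \<Longrightarrow>
      take k (permute_list \<pi> xs) = map (\<lambda>i. xs ! (\<sigma> i - 1)) [1..<k + 1]"
    and "length xs = n \<Longrightarrow> k \<le> m \<Longrightarrow>
      take (m - k + 1) (drop k (permute_list \<pi> xs)) =
        map (\<lambda>i. xs ! (\<sigma> i - 1)) [k + 1..<m + 1] @ [xs ! m]"
    and "length xs = n \<Longrightarrow> drop (m + 1) (permute_list \<pi> xs) = drop (m + 1) xs"
proof -
  have pos: "1 \<le> \<sigma> (i + 1)" for i
    using permutes_in_image[OF \<sigma>, of "i + 1"] permutes_not_in[OF \<sigma>, of "i + 1"]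
    by (cases "i + 1 \<in> {1..m}") auto
  have stay: "\<pi> i = i" if "m \<le> i" for i
    using permutes_not_in[OF \<sigma>, of "i + 1"] that by (simp add: \<pi>_def)
  have in_m: "\<pi> i < m" if "i < m" for i
    using permutes_in_image[OF \<sigma>, of "i + 1"] that by (auto simp: \<pi>_def)
  have "inj \<pi>"
  proof (rule injI)
    fix i j assume "\<pi> i = \<pi> j"
    then have "\<sigma> (i + 1) = \<sigma> (j + 1)" using pos[of i] pos[of j] by (simp add: \<pi>_def)
    then show "i = j" using permutes_inj[OF \<sigma>] by (auto dest: injD)
  qed
  moreover have "\<pi> ` {..<n} \<subseteq> {..<n}"
    using in_m stay m by (auto, metis not_le order_less_trans)
  ultimately have "bij_betw \<pi> {..<n} {..<n}"
    using endo_inj_surj[of "{..<n}" \<pi>] inj_on_subset[of \<pi> UNIV "{..<n}"]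
    by (simp add: bij_betw_def)
  then show "\<pi> permutes {..<n}"
    using stay m by (intro bij_imp_permutes) auto
  then have nth: "permute_list \<pi> xs ! i = xs ! (\<pi> i)" if "length xs = n" "i < n" for i
    using permute_list_nth[of \<pi> xs i] that by simp
  then have nth_\<sigma>: "permute_list \<pi> xs ! i = xs ! (\<sigma> (i + 1) - 1)" if "length xs = n" "i < n" for i
    using that by (simp add: \<pi>_def)
  show "take k (permute_list \<pi> xs) = map (\<lambda>i. xs ! (\<sigma> i - 1)) [1..<k + 1]"
    if "length xs = n" "k \<le> m"
    using that m by (intro nth_equalityI) (auto simp: nth_\<sigma> simp del: upt_Suc)
  show "take (m - k + 1) (drop k (permute_list \<pi> xs)) =
      map (\<lambda>i. xs ! (\<sigma> i - 1)) [k + 1..<m + 1] @ [xs ! m]" if "length xs = n" "k \<le> m"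
  proof (intro nth_equalityI)
    fix i assume "i < length (take (m - k + 1) (drop k (permute_list \<pi> xs)))"
    then have "i \<le> m - k" using that m by simp
    moreover have "permute_list \<pi> xs ! m = xs ! m"
      using nth[OF that(1) m] stay by simp
    moreover have "permute_list \<pi> xs ! (k + i) = xs ! (\<sigma> (k + i + 1) - 1)" if "i < m - k"
      using nth_\<sigma>[OF \<open>length xs = n\<close>, of "k + i"] that m by simp
    ultimately show "take (m - k + 1) (drop k (permute_list \<pi> xs)) ! i =
        (map (\<lambda>i. xs ! (\<sigma> i - 1)) [k + 1..<m + 1] @ [xs ! m]) ! i"
      using that m by (cases "i = m - k") (auto simp: nth_append simp del: upt_Suc)
  qed (use that m in \<open>simp add: Suc_diff_Suc del: upt_Suc\<close>)
  show "drop (m + 1) (permute_list \<pi> xs) = drop (m + 1) xs" if "length xs = n"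
    using that by (intro nth_equalityI) (auto simp: nth stay)
qed

lemma (in vector_space) circ_in_cochains:
  assumes P: "P \<in> cochains scale p" and Q: "Q \<in> cochains scale q"
  shows "circ scale p q P Q \<in> cochains scale (p + q)"
proof -
  let ?T = "\<lambda>k \<sigma> xs. P (map (\<lambda>i. xs ! (\<sigma> i - 1)) [1..<k + 1] @
           [Q (map (\<lambda>i. xs ! (\<sigma> i - 1)) [k + 1..<k + q + 1] @ [xs ! (k + q + 1 - 1)])] @
           drop (k + q + 1) xs)"
  have T: "multilinear scale (p + q + 1) (?T k \<sigma>)" if "k \<le> p" "\<sigma> \<in> shuffles k q" for k \<sigma>
  proof -
    let ?\<pi> = "\<lambda>i. \<sigma> (i + 1) - 1"
    have \<sigma>: "\<sigma> permutes {1..k + q}" using that by (simp add: shuffles_def)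
    have m: "k + q < p + q + 1" using that by simp
    note A = shuffle_arguments_eq_permute_list[OF \<sigma> m]
    have "?T k \<sigma> xs = P (take k (permute_list ?\<pi> xs) @
        [Q (take (q + 1) (drop k (permute_list ?\<pi> xs)))] @
        drop (k + q + 1) (permute_list ?\<pi> xs))" if "length xs = p + q + 1" for xs
      using A(2)[OF that, of k] A(3)[OF that, of k] A(4)[OF that] by simp
    moreover have "multilinear scale (p + q + 1) (\<lambda>xs. P (take k (permute_list ?\<pi> xs) @
        [Q (take (q + 1) (drop k (permute_list ?\<pi> xs)))] @
        drop (k + q + 1) (permute_list ?\<pi> xs)))"
      using P Q that(1)
      by (intro multilinear_permute[OF multilinear_insert A(1)])
        (simp_all add: cochains_iff_multilinear)
    ultimately show ?thesis
      by (rule multilinear_cong[THEN iffD2])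
  qed
  have "multilinear scale (p + q + 1) (\<lambda>xs. \<Sum>k = 0..p. scale ((-1) ^ (k * q))
      (\<Sum>\<sigma> \<in> shuffles k q. scale (of_int (sign \<sigma>)) (?T k \<sigma> xs)))"
    by (intro multilinear_sum multilinear_scale T) auto
  then have "multilinear scale (p + q + 1) (circ scale p q P Q)"
    by (rule multilinear_cong[THEN iffD1, rotated]) (simp add: circ_def)
  then show ?thesis
    by (simp add: cochains_iff_multilinear circ_def)
qed

lemma (in vector_space) subspace_cochains: "module.subspace (fun_scale scale) (cochains scale k)"
proof -
  interpret F: vector_space "fun_scale scale :: _ \<Rightarrow> ('b list \<Rightarrow> 'b) \<Rightarrow> _"
    by (rule vector_space_fun_scale) (rule vector_space_axioms)
  show ?thesis
    using multilinear_add[of "k + 1"] multilinear_scale[of "k + 1"]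
      multilinear_sum[of "{}" "k + 1"]
    by (auto simp: F.subspace_def cochains_iff_multilinear fun_scale_def plus_fun_def zero_fun_def)
qed

lemma (in vector_space) bracketC_in_subspace:
  assumes "module.subspace (fun_scale scale) S"
    and "circ scale p q P Q \<in> S" and "circ scale q p Q P \<in> S"
  shows "bracketC scale p q P Q \<in> S"
proof -
  interpret F: vector_space "fun_scale scale :: _ \<Rightarrow> ('b list \<Rightarrow> 'b) \<Rightarrow> _"
    by (rule vector_space_fun_scale) (rule vector_space_axioms)
  show ?thesis
    using assms unfolding bracketC_def by (intro F.subspace_add F.subspace_scale)
qed

section \<open>The coboundary\<close>

lemma length_omit: "1 \<le> i \<Longrightarrow> i \<le> length xs \<Longrightarrow> length (omit i xs) = length xs - 1"
  by (simp add: omit_def)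

lemma set_omit: "set (omit i xs) \<subseteq> set xs"
  by (auto simp: omit_def dest: in_set_takeD in_set_dropD)

lemma omit_list_update:
  assumes "1 \<le> i" and "i \<le> length xs"
  shows "omit i (xs[m := v]) =
    (if m < i - 1 then (omit i xs)[m := v]
     else if m = i - 1 then omit i xs else (omit i xs)[m - 1 := v])"
proof -
  consider "m < i - 1" | "m = i - 1" | r where "m = i + r"
  proof (cases "i \<le> m")
    case True
    then show thesis using that(3) le_Suc_ex by blast
  qed (use that(1,2) in linarith)
  then show ?thesis
  proof cases
    case 1
    then have "(take (i - 1) xs @ drop i xs)[m := v] = (take (i - 1) xs)[m := v] @ drop i xs"
      using assms by (intro list_update_append1) simp
    then show ?thesis
      using 1 by (simp add: omit_def take_update_swap)
  next
    case 2
    then show ?thesis using assms by (simp add: omit_def)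
  next
    case (3 r)
    have "(take (i - 1) xs @ drop i xs)[m - 1 := v] = take (i - 1) xs @ (drop i xs)[r := v]"
      using assms 3 by (simp add: list_update_append)
    then show ?thesis
      using 3 assms by (simp add: omit_def drop_update_swap)
  qed
qed

text \<open>
  An argument is either the one omitted from \<open>c\<close>, which \<open>b\<close> receives, or an argument of
  \<open>c\<close>. Since \<open>b\<close> is an arbitrary bilinear map, this covers the brackets of a Leibniz
  algebra from both sides.
\<close>

lemma multilinear_pair_omit:
  fixes b :: "'e::ab_group_add \<Rightarrow> 'e \<Rightarrow> 'e"
  assumes b: "\<And>y. Vector_Spaces.linear s s (\<lambda>x. b x y)" "\<And>x. Vector_Spaces.linear s s (b x)"
    and c: "multilinear s n c" and i: "1 \<le> i" "i \<le> n + 1"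
  shows "multilinear s (n + 1) (\<lambda>xs. b (xs ! (i - 1)) (c (omit i xs)))"
proof (rule multilinearI)
  fix xs :: "'e list" and m assume len: "length xs = n + 1" and m: "m < n + 1"
  have o: "length (omit i xs) = n" using i len by (simp add: length_omit)
  have *: "Vector_Spaces.linear s s (\<lambda>v. b (xs ! (i - 1)) (c ((omit i xs)[l := v])))"
    if "l < n" for l
    using Vector_Spaces.linear_compose[OF multilinearD[OF c o that] b(2)] by (simp add: o_def)
  consider "m < i - 1" | "m = i - 1" | "\<not> m < i - 1" "m \<noteq> i - 1" "m - 1 < n"
    using i m by linarith
  then show "Vector_Spaces.linear s s (\<lambda>v. b (xs[m := v] ! (i - 1)) (c (omit i (xs[m := v]))))"
  proof cases
    case 1
    then have "omit i (xs[m := v]) = (omit i xs)[m := v]" and "xs[m := v] ! (i - 1) = xs ! (i - 1)"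
      for v
      using i len by (simp_all add: omit_list_update)
    moreover have "m < n" using 1 i by linarith
    ultimately show ?thesis by (simp only: *)
  next
    case 2
    then have "omit i (xs[m := v]) = omit i xs" and "xs[m := v] ! (i - 1) = v" for v
      using i len by (simp_all add: omit_list_update)
    then show ?thesis by (simp only: b(1))
  next
    case 3
    then have "omit i (xs[m := v]) = (omit i xs)[m - 1 := v]" and "xs[m := v] ! (i - 1) = xs ! (i - 1)"
      for v
      using i len by (simp_all add: omit_list_update)
    then show ?thesis by (simp only: *[OF 3(3)])
  qed
qed

text \<open>
  The arguments \<open>i\<close> and \<open>j\<close> both enter the slot of \<open>c\<close> in which their product
  stands, but each of them only linearly; all others have a slot of their own.
\<close>

lemma multilinear_omit_contract:
  fixes b :: "'e::ab_group_add \<Rightarrow> 'e \<Rightarrow> 'e"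
  assumes b: "\<And>y. Vector_Spaces.linear s s (\<lambda>x. b x y)" "\<And>x. Vector_Spaces.linear s s (b x)"
    and c: "multilinear s n c" and ij: "1 \<le> i" "i < j" "j \<le> n + 1"
  shows "multilinear s (n + 1)
    (\<lambda>xs. c (omit i (xs[j - 1 := b (xs ! (i - 1)) (xs ! (j - 1))])))"
proof (rule multilinearI)
  fix xs :: "'e list" and m assume len: "length xs = n + 1" and m: "m < n + 1"
  let ?f = "\<lambda>xs. c (omit i (xs[j - 1 := b (xs ! (i - 1)) (xs ! (j - 1))]))"
  have o: "length (omit i xs) = n" using ij len by (simp add: length_omit)
  have ij': "\<not> j - 1 < i - 1" "j - 1 \<noteq> i - 1" using ij by linarith+
  \<comment> \<open>Position \<open>j - 1\<close>, counted from \<open>0\<close>, moves down by one since \<open>i < j\<close>.\<close>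
  have slot: "c (omit i (xs[j - 1 := w])) = c ((omit i xs)[j - 2 := w])" for w
    using ij ij' len by (simp add: omit_list_update numeral_2_eq_2)
  have lin: "Vector_Spaces.linear s s (\<lambda>w. c ((omit i xs)[j - 2 := w]))"
    using ij by (intro multilinearD[OF c o]) simp
  consider "m = i - 1" | "m = j - 1" | "m \<noteq> i - 1" "m \<noteq> j - 1" by blast
  then show "Vector_Spaces.linear s s (\<lambda>v. ?f (xs[m := v]))"
  proof cases
    case 1
    then have "?f (xs[m := v]) = c ((omit i xs)[j - 2 := b v (xs ! (j - 1))])" for v
      using ij ij' len by (simp add: omit_list_update numeral_2_eq_2)
    then show ?thesis using Vector_Spaces.linear_compose[OF b(1) lin] by (simp add: o_def)
  next
    case 2
    then have "?f (xs[m := v]) = c ((omit i xs)[j - 2 := b (xs ! (i - 1)) v])" for v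
      using ij ij' len by (simp add: omit_list_update numeral_2_eq_2)
    then show ?thesis using Vector_Spaces.linear_compose[OF b(2) lin] by (simp add: o_def)
  next
    case 3
    define ys where "ys = omit i (xs[j - 1 := b (xs ! (i - 1)) (xs ! (j - 1))])"
    have ys: "length ys = n" using ij len by (simp add: ys_def length_omit)
    define l where "l = (if m < i - 1 then m else m - 1)"
    have "?f (xs[m := v]) = c (omit i (xs[j - 1 := b (xs ! (i - 1)) (xs ! (j - 1)), m := v]))" for v
      by (simp only: list_update_swap[OF 3(2)] nth_list_update_neq[OF 3(1)] nth_list_update_neq[OF 3(2)])
    moreover have "omit i (zs[m := v]) = (omit i zs)[l := v]" if "length zs = n + 1" for zs :: "'e list" and v
      using 3(1) ij that by (simp add: omit_list_update l_def)
    ultimately have "?f (xs[m := v]) = c (ys[l := v])" for v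
      using len by (simp add: ys_def)
    moreover have "l < n" using 3 ij m by (auto simp: l_def)
    ultimately show ?thesis using multilinearD[OF c ys] by simp
  qed
qed

lemma (in leibniz_algebra) coboundary_in_cochains:
  assumes "c \<in> cochains s p"
  shows "coboundary s br p c \<in> cochains s (p + 1)"
proof -
  have c: "multilinear s (p + 1) c" using assms by (simp add: cochains_iff_multilinear)
  \<comment> \<open>The term with \<open>c\<close> on the left omits the last argument; here \<open>b\<close> is the opposite bracket.\<close>
  have "multilinear s (p + 1 + 1) (\<lambda>xs. br (c (omit (p + 2) xs)) (xs ! (p + 2 - 1)))"
    by (rule multilinear_pair_omit[OF linear_right linear_left c]) simp_all
  moreover have "multilinear s (p + 1 + 1) (\<lambda>xs. br (c (omit (p + 2) xs)) (xs ! (p + 2 - 1))) \<longleftrightarrow>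
      multilinear s (p + 1 + 1) (\<lambda>xs. br (c (take (p + 1) xs)) (xs ! (p + 1)))"
    by (rule multilinear_cong) (simp add: omit_def)
  ultimately have last:
    "multilinear s (p + 1 + 1) (\<lambda>xs. br (c (take (p + 1) xs)) (xs ! (p + 1)))" by simp
  have "multilinear s (p + 1 + 1) (\<lambda>xs.
        (\<Sum>i = 1..p + 1. s ((-1) ^ (i + 1)) (br (xs ! (i - 1)) (c (omit i xs))))
      + s ((-1) ^ (p + 1 + 1)) (br (c (take (p + 1) xs)) (xs ! (p + 1)))
      + (\<Sum>a \<in> {(i, j). 1 \<le> i \<and> i < j \<and> j \<le> p + 1 + 1}.
          s ((-1) ^ fst a) (c (omit (fst a)
            (xs[snd a - 1 := br (xs ! (fst a - 1)) (xs ! (snd a - 1))])))))"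
    by (intro multilinear_add multilinear_sum multilinear_scale last
        multilinear_pair_omit[OF linear_left linear_right c]
        multilinear_omit_contract[OF linear_left linear_right c]) auto
  then have "multilinear s (p + 1 + 1) (coboundary s br p c)"
    by (rule multilinear_cong[THEN iffD1, rotated])
      (simp add: coboundary_def Let_def case_prod_beta)
  then show ?thesis
    by (simp add: cochains_iff_multilinear coboundary_def)
qed

section \<open>Cochains with values in the second summand\<close>

lemma cochains_gtI:
  assumes "P \<in> cochains (dsum_scale sg sh) k" and "\<And>xs. P xs \<in> second_summand"
    and "\<And>xs. length xs = k + 1 \<Longrightarrow> set xs \<subseteq> second_summand \<Longrightarrow> P xs = 0"
  shows "P \<in> cochains_gt sg sh k"
  using assms by (simp add: cochains_gt_def cochains_into_snd_def)

lemma cochains_gtD: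
  assumes "P \<in> cochains_gt sg sh k"
  shows "P \<in> cochains (dsum_scale sg sh) k" and "P xs \<in> second_summand"
    and "length xs = k + 1 \<Longrightarrow> set xs \<subseteq> second_summand \<Longrightarrow> P xs = 0"
  using assms by (simp_all add: cochains_gt_def cochains_into_snd_def)

context vector_space_prod
begin

lemma subspace_second_summand: "p.subspace second_summand"
  by (auto simp: p.subspace_def second_summand_def scale_def zero_prod_def)

lemma subspace_cochains_gt: "module.subspace (fun_scale scale) (cochains_gt s1 s2 k)"
proof -
  interpret F: vector_space "fun_scale scale :: _ \<Rightarrow> (('b \<times> 'c) list \<Rightarrow> 'b \<times> 'c) \<Rightarrow> _"
    by (rule vector_space_fun_scale) (rule p.vector_space_axioms)
  show ?thesis
    using p.subspace_cochains[of k] subspace_second_summand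
    by (auto simp: F.subspace_def p.subspace_def cochains_gt_def cochains_into_snd_def
        fun_scale_def)
qed

text \<open>
  The vanishing of \<open>P\<close> on \<open>\<hh>\<close> alone makes \<open>P \<circ> Q\<close> vanish there; from \<open>Q\<close>
  it takes only the values in \<open>\<hh>\<close>, which keep the arguments of \<open>P\<close> in \<open>\<hh>\<close>.
\<close>

lemma circ_in_cochains_gt:
  assumes P: "P \<in> cochains_gt s1 s2 p" and Q: "Q \<in> cochains_gt s1 s2 q"
  shows "circ scale p q P Q \<in> cochains_gt s1 s2 (p + q)"
proof (rule cochains_gtI)
  show "circ scale p q P Q \<in> cochains scale (p + q)"
    using P Q by (intro p.circ_in_cochains cochains_gtD)
  show "circ scale p q P Q xs \<in> second_summand" for xs
    unfolding circ_def
    by (auto intro!: p.subspace_sum p.subspace_scale p.subspace_0 subspace_second_summand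
        cochains_gtD(2)[OF P])
  fix xs :: "('b \<times> 'c) list"
  assume len: "length xs = p + q + 1" and xs: "set xs \<subseteq> second_summand"
  have "P (map (\<lambda>i. xs ! (\<sigma> i - 1)) [1..<k + 1] @
           [Q (map (\<lambda>i. xs ! (\<sigma> i - 1)) [k + 1..<k + q + 1] @ [xs ! (k + q + 1 - 1)])] @
           drop (k + q + 1) xs) = 0" if k: "k \<le> p" and "\<sigma> \<in> shuffles k q" for k \<sigma>
  proof (rule cochains_gtD(3)[OF P])
    have \<sigma>: "\<sigma> permutes {1..k + q}" using that by (simp add: shuffles_def)
    have "xs ! (\<sigma> i - 1) \<in> second_summand" if "i \<in> {1..k}" for i
    proof -
      have "\<sigma> i \<in> {1..k + q}" using permutes_in_image[OF \<sigma>, of i] that by simp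
      then have "\<sigma> i - 1 < length xs" unfolding atLeastAtMost_iff len using k by linarith
      then show ?thesis using xs nth_mem by blast
    qed
    then show "set (map (\<lambda>i. xs ! (\<sigma> i - 1)) [1..<k + 1] @
           [Q (map (\<lambda>i. xs ! (\<sigma> i - 1)) [k + 1..<k + q + 1] @ [xs ! (k + q + 1 - 1)])] @
           drop (k + q + 1) xs) \<subseteq> second_summand"
      using xs cochains_gtD(2)[OF Q] set_drop_subset[of "k + q + 1" xs]
      by (auto simp del: upt_Suc)
  qed (use k len in \<open>simp del: upt_Suc\<close>)
  then show "circ scale p q P Q xs = 0"
    by (simp add: circ_def)
qed

text \<open>Here the values of \<open>Q\<close> are arguments of \<open>P\<close>, so \<open>P\<close> sees nothing but \<open>\<hh>\<close>.\<close>

lemma circ_degree_0_eq_0: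
  assumes P: "P \<in> cochains_gt s1 s2 0" and Q: "Q \<in> cochains_gt s1 s2 0"
  shows "circ scale 0 0 P Q = 0"
proof
  fix xs :: "('b \<times> 'c) list"
  have "P [Q [xs ! 0]] = 0" using cochains_gtD(2)[OF Q] by (intro cochains_gtD(3)[OF P]) simp_all
  then show "circ scale 0 0 P Q xs = 0 xs"
    by (auto simp: circ_def)
qed

lemma linear_hom_cochain:
  "Vector_Spaces.linear (fun_scale s2) (fun_scale scale) (hom_cochain :: ('b \<Rightarrow> 'c) \<Rightarrow> _)"
  using vector_space_fun_scale[OF vs2.vector_space_axioms]
    vector_space_fun_scale[OF p.vector_space_axioms]
  by (auto simp: Vector_Spaces.linear_iff hom_cochain_def fun_scale_def scale_def fun_eq_iff
      zero_prod_def)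

text \<open>
  A linear map on \<open>\<gg> \<oplus> \<hh>\<close> that vanishes on \<open>\<hh>\<close> is determined by its
  restriction to \<open>\<gg>\<close>.
\<close>

lemma bij_betw_hom_cochain:
  "bij_betw hom_cochain {f. Vector_Spaces.linear s1 s2 f} (cochains_gt s1 s2 0)"
proof (rule bij_betwI[where g = "\<lambda>P x. snd (P [(x, 0)])"])
  have l1: "xs[i := v] = [v]" if "length xs = Suc 0" "i < Suc 0" for xs :: "'d list" and i v
    using that by (cases xs) auto
  show "hom_cochain \<in> {f. Vector_Spaces.linear s1 s2 f} \<rightarrow> cochains_gt s1 s2 0"
  proof
    fix f assume f: "f \<in> {f. Vector_Spaces.linear s1 s2 f}"
    then have "f 0 = 0" using linear_imp_0 by blast
    then show "hom_cochain f \<in> cochains_gt s1 s2 0"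
      using f p.vector_space_axioms
      by (intro cochains_gtI)
        (auto simp: cochains_def Vector_Spaces.linear_iff hom_cochain_def second_summand_def
          scale_def zero_prod_def length_Suc_conv)
  qed
  have P: "Vector_Spaces.linear scale scale (\<lambda>v. P [v])" if "P \<in> cochains_gt s1 s2 0" for P
    using multilinearD[of scale 1 P "[undefined]" 0] cochains_gtD(1)[OF that]
    by (simp add: cochains_iff_multilinear)
  show "(\<lambda>P x. snd (P [(x, 0)])) \<in> cochains_gt s1 s2 0 \<rightarrow> {f. Vector_Spaces.linear s1 s2 f}"
  proof
    fix P assume "P \<in> cochains_gt s1 s2 0"
    from P[OF this] have add: "P [u + v] = P [u] + P [v]" and scl: "P [scale a v] = scale a (P [v])"
      for u v a unfolding Vector_Spaces.linear_iff by blast+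
    have "snd (P [(x + y, 0)]) = snd (P [(x, 0)]) + snd (P [(y, 0)])" for x y
      using add[of "(x, 0)" "(y, 0)"] by simp
    moreover have "snd (P [(s1 a x, 0)]) = s2 a (snd (P [(x, 0)]))" for a x
      using scl[of a "(x, 0)"] by (simp add: scale_def)
    ultimately show "(\<lambda>x. snd (P [(x, 0)])) \<in> {f. Vector_Spaces.linear s1 s2 f}"
      using vs1.vector_space_axioms vs2.vector_space_axioms by (simp add: Vector_Spaces.linear_iff)
  qed
  show "(\<lambda>x. snd (hom_cochain f [(x, 0)])) = f" for f :: "'b \<Rightarrow> 'c"
    by (simp add: hom_cochain_def)
  fix P assume gt: "P \<in> cochains_gt s1 s2 0"
  show "hom_cochain (\<lambda>x. snd (P [(x, 0)])) = P"
  proof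
    fix xs :: "('b \<times> 'c) list"
    show "hom_cochain (\<lambda>x. snd (P [(x, 0)])) xs = P xs"
    proof (cases "length xs = 1")
      case True
      then obtain x a where xs: "xs = [(x, a)]" by (cases xs) auto
      have "P [(x, a)] = P [(x, 0)] + P [(0, a)]"
        using P[OF gt] unfolding Vector_Spaces.linear_iff
        by (metis add.left_neutral add.right_neutral add_Pair)
      also have "P [(0, a)] = 0"
        by (rule cochains_gtD(3)[OF gt]) (simp_all add: second_summand_def)
      finally have "P xs = P [(x, 0)]" using xs by simp
      moreover have "fst (P [(x, 0)]) = 0"
        using cochains_gtD(2)[OF gt, of "[(x, 0)]"] by (auto simp: second_summand_def)
      ultimately show ?thesis by (simp add: hom_cochain_def xs prod_eq_iff)
    next
      case False
      then show ?thesis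
        using cochains_gtD(1)[OF gt] by (simp add: hom_cochain_def cochains_def)
    qed
  qed
qed

end

text \<open>
  The bracket is taken componentwise, and its first component has an argument \<open>0\<close>.
\<close>

lemma dsum_br_second_summand:
  assumes "leibniz_algebra sg brg" and "v \<in> second_summand"
  shows "dsum_br brg brh u v \<in> second_summand" and "dsum_br brg brh v u \<in> second_summand"
proof -
  interpret leibniz_algebra sg brg by fact
  have "brg x 0 = 0" "brg 0 x = 0" for x
    using linear_imp_0[OF linear_right[of x]] linear_imp_0[OF linear_left[of x]] .
  then show "dsum_br brg brh u v \<in> second_summand" "dsum_br brg brh v u \<in> second_summand"
    using assms(2) by (auto simp: dsum_br_def second_summand_def)
qed

lemma coboundary_in_cochains_gt:
  assumes g: "leibniz_algebra sg brg" and h: "leibniz_algebra sh brh"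
    and c: "c \<in> cochains_gt sg sh p"
  shows "coboundary (dsum_scale sg sh) (dsum_br brg brh) p c \<in> cochains_gt sg sh (p + 1)"
proof (rule cochains_gtI)
  interpret g: leibniz_algebra sg brg by fact
  interpret h: leibniz_algebra sh brh by fact
  interpret vector_space_prod sg sh ..
  interpret E: leibniz_algebra scale "dsum_br brg brh"
    using g h by (rule leibniz_algebra_dsum)
  let ?br = "dsum_br brg brh"
  note br_snd = dsum_br_second_summand[OF g, of _ brh]
  show "coboundary scale ?br p c \<in> cochains scale (p + 1)"
    using c by (intro E.coboundary_in_cochains cochains_gtD)
  have br_c: "?br u (c ys) \<in> second_summand" "?br (c ys) u \<in> second_summand" "c ys \<in> second_summand"
    for u ys
    using cochains_gtD(2)[OF c] by (simp_all add: br_snd)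
  note mem = p.subspace_add[OF subspace_second_summand] p.subspace_sum[OF subspace_second_summand]
    p.subspace_scale[OF subspace_second_summand] p.subspace_0[OF subspace_second_summand]
  have if_mem: "(if a then u else v) \<in> second_summand"
    if "u \<in> second_summand" "v \<in> second_summand" for a and u v :: "'b \<times> 'c"
    using that by simp
  show "coboundary scale ?br p c xs \<in> second_summand" for xs
    unfolding coboundary_def Let_def case_prod_unfold
    by (intro if_mem mem br_c)
  fix xs :: "('b \<times> 'c) list"
  assume len: "length xs = p + 1 + 1" and xs: "set xs \<subseteq> second_summand"
  have br0: "?br u 0 = 0" "?br 0 u = 0" for u
    using linear_imp_0[OF E.linear_right[of u]] linear_imp_0[OF E.linear_left[of u]] .
  have c0: "c ys = 0" if "length ys = p + 1" "set ys \<subseteq> second_summand" for ys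
    using cochains_gtD(3)[OF c that] .
  have "c (omit i xs) = 0" if "1 \<le> i" "i \<le> p + 1" for i
    using that len xs set_omit[of i xs] by (intro c0) (auto simp: length_omit)
  moreover have "c (take (p + 1) xs) = 0"
    using len xs set_take_subset[of "p + 1" xs] by (intro c0) auto
  moreover have "c (omit i (xs[j - 1 := ?br (xs ! (i - 1)) (xs ! (j - 1))])) = 0"
    if "1 \<le> i" "i < j" "j \<le> p + 1 + 1" for i j
  proof (rule c0)
    have "xs ! (j - 1) \<in> second_summand" using that len xs by (auto intro!: nth_mem)
    then show "set (omit i (xs[j - 1 := ?br (xs ! (i - 1)) (xs ! (j - 1))])) \<subseteq> second_summand"
      by (intro order_trans[OF set_omit] set_update_subsetI xs br_snd(1))
  qed (use that len in \<open>simp add: length_omit\<close>)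
  ultimately show "coboundary scale ?br p c xs = 0"
    unfolding coboundary_def Let_def case_prod_unfold by (simp add: br0 len)
qed

theorem lemma4p2:
  fixes sg :: "'k::field \<Rightarrow> 'g::ab_group_add \<Rightarrow> 'g"
    and brg :: "'g \<Rightarrow> 'g \<Rightarrow> 'g"
    and sh :: "'k \<Rightarrow> 'h::ab_group_add \<Rightarrow> 'h"
    and brh :: "'h \<Rightarrow> 'h \<Rightarrow> 'h"
  assumes "leibniz_algebra sg brg" and "leibniz_algebra sh brh"
  shows "(\<forall>k. coboundary (dsum_scale sg sh) (dsum_br brg brh) k ` cochains_gt sg sh k
            \<subseteq> cochains_gt sg sh (k + 1))
    \<and> sub_dgla (fun_scale (dsum_scale sg sh))
        (cochains (dsum_scale sg sh))
        (bracketC (dsum_scale sg sh))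
        (coboundary_bar (dsum_scale sg sh) (dsum_br brg brh))
        (cochains_gt sg sh)
    \<and> Vector_Spaces.linear (fun_scale sh) (fun_scale (dsum_scale sg sh))
        (hom_cochain :: ('g \<Rightarrow> 'h) \<Rightarrow> ('g \<times> 'h) list \<Rightarrow> 'g \<times> 'h)
    \<and> bij_betw hom_cochain {f. Vector_Spaces.linear sg sh f} (cochains_gt sg sh 0)
    \<and> (\<forall>P \<in> cochains_gt sg sh 0. \<forall>Q \<in> cochains_gt sg sh 0.
          bracketC (dsum_scale sg sh) 0 0 P Q = 0)"
proof -
  interpret g: leibniz_algebra sg brg by fact
  interpret h: leibniz_algebra sh brh by fact
  interpret vector_space_prod sg sh ..
  interpret F: vector_space "fun_scale scale :: _ \<Rightarrow> (('g \<times> 'h) list \<Rightarrow> 'g \<times> 'h) \<Rightarrow> _"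
    by (rule vector_space_fun_scale) (rule p.vector_space_axioms)
  note coboundary = coboundary_in_cochains_gt[OF assms]
  have "sub_dgla (fun_scale scale) (cochains scale) (bracketC scale)
      (coboundary_bar scale (dsum_br brg brh)) (cochains_gt sg sh)"
    unfolding sub_dgla_def
  proof (intro conjI allI ballI subsetI)
    fix k q P Q assume P: "P \<in> cochains_gt sg sh k" and Q: "Q \<in> cochains_gt sg sh q"
    show "bracketC scale k q P Q \<in> cochains_gt sg sh (k + q)"
      using circ_in_cochains_gt[OF P Q] circ_in_cochains_gt[OF Q P]
      by (intro p.bracketC_in_subspace subspace_cochains_gt) (simp_all add: add.commute)
  next
    fix k P assume "P \<in> cochains_gt sg sh k"
    then show "coboundary_bar scale (dsum_br brg brh) k P \<in> cochains_gt sg sh (Suc k)"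
      using coboundary[of P k] unfolding coboundary_bar_def
      by (intro F.subspace_scale subspace_cochains_gt) simp
  qed (auto intro: cochains_gtD(1) subspace_cochains_gt)
  moreover have "bracketC scale 0 0 P Q = 0"
    if "P \<in> cochains_gt sg sh 0" "Q \<in> cochains_gt sg sh 0" for P Q
    using that by (simp add: bracketC_def circ_degree_0_eq_0)
  ultimately show ?thesis
    using coboundary linear_hom_cochain bij_betw_hom_cochain by blast
qed

end
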